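(* The function $\phi:(0,\infty)\to\mathbb{R}$ defined by $$\phi(x)=\psi(x)+\ln\bigl(e^{1/x}-1\bigr)$$ is strictly increasing on $(0,\infty)$, where $\psi(x)=\frac{\Gamma'(x)}{\Gamma(x)}$ is the psi (digamma) function.
   Context: For $x>0$, $\Gamma(x)=\int_0^\infty t^{x-1}e^{-t}\,\mathrm{d}t$ is the classical gamma function, and $\psi(x)=\frac{\Gamma'(x)}{\Gamma(x)}$ is the psi (digamma) function. Here $\ln$ denotes the natural logarithm. *)

theory Defs
  imports "HOL-Analysis.Analysis"
begin

text \<open>
  The library's \<open>Gamma\<close> is not defined by Euler's integral; on the positive reals the two agree.
\<close>

lemma Gamma_eq_Euler_integral:
  fixes x :: real
  assumes "x > 0"
  shows "Gamma x = integral {0..} (\<lambda>t. t powr (x - 1) * exp (- t))"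
  using integral_unique[OF Gamma_integral_real[OF assms]]
  by (simp add: exp_minus divide_inverse)

text \<open>
  The library's \<open>Digamma\<close> is defined by a series; on the positive reals it is the logarithmic
  derivative of \<open>Gamma\<close>.
\<close>

lemma deriv_Gamma_divide_Gamma:
  fixes x :: real
  assumes "x > 0"
  shows "deriv Gamma x / Gamma x = Digamma x"
proof -
  have "x \<notin> \<int>\<^sub>\<le>\<^sub>0"
    using assms by (auto elim: nonpos_Ints_cases)
  then have "deriv Gamma x = Gamma x * Digamma x"
    by (intro DERIV_imp_deriv has_field_derivative_Gamma)
  moreover have "Gamma x > 0"
    using assms by (rule Gamma_real_pos)
  ultimately show ?thesis
    by simp
qed

end

theory Submission
  imports Defs "HOL-Real_Asymp.Real_Asymp"
begin

text \<open>
  The derivative of the function is \<open>\<psi>'(x) - g(x)\<close> with \<open>g(x) = 1 / (x\<^sup>2 (1 - exp (-1/x)))\<close>.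
  By the recurrence \<open>\<psi>'(x + 1) = \<psi>'(x) - 1/x\<^sup>2\<close>, this derivative strictly decreases along the
  shift \<open>x \<mapsto> x + 1\<close> as soon as \<open>(x + 1)\<^sup>2 (1 - exp (-1/(x + 1))) < x\<^sup>2 (exp (1/x) - 1)\<close>, and
  the cubic Taylor polynomial of \<open>exp\<close> separates the two sides. Since \<open>\<psi>' > 0\<close> and \<open>g\<close> vanishes at
  infinity, the derivative is positive.
\<close>

text \<open>The Lagrange remainder has even degree four, so it is nonnegative for either sign of
  \<open>x\<close>; both signs are needed below.\<close>

lemma exp_ge_cubic_Taylor:
  fixes x :: real
  shows "1 + x + x ^ 2 / 2 + x ^ 3 / 6 \<le> exp x"
proof -
  obtain t where "exp x = (\<Sum>m<4. x ^ m / fact m) + exp t / fact 4 * x ^ 4"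
    using Maclaurin_exp_le[of x 4] by auto
  moreover have "(\<Sum>m<4. x ^ m / fact m) = 1 + x + x ^ 2 / 2 + x ^ 3 / 6"
    by (simp add: eval_nat_numeral)
  moreover have "0 \<le> exp t / fact 4 * x ^ 4"
    by simp
  ultimately show ?thesis
    by linarith
qed

lemma exp_reciprocal_shift_less:
  fixes x :: real
  assumes "x > 0"
  shows "(x + 1)\<^sup>2 * (1 - exp (- (1 / (x + 1)))) < x\<^sup>2 * (exp (1 / x) - 1)"
proof -
  define y where "y = x + 1"
  have y: "y > 0" "x < y" "y = x + 1"
    using assms by (auto simp: y_def)
  have "y\<^sup>2 * (1 - exp (- (1 / y)))
          \<le> y\<^sup>2 * (1 - (1 + - (1 / y) + (- (1 / y)) ^ 2 / 2 + (- (1 / y)) ^ 3 / 6))"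
    using exp_ge_cubic_Taylor[of "- (1 / y)"] by (intro mult_left_mono) auto
  also have "\<dots> = y - 1 / 2 + 1 / (6 * y)"
    using y(1) by (simp add: field_simps power2_eq_square power3_eq_cube)
  \<comment> \<open>As \<open>y - 1 / 2 = x + 1 / 2\<close>, only 1/(6y) < 1/(6x) is left.\<close>
  also have "\<dots> < x + 1 / 2 + 1 / (6 * x)"
    using assms y by (simp add: field_simps)
  also have "\<dots> = x\<^sup>2 * (1 + 1 / x + (1 / x) ^ 2 / 2 + (1 / x) ^ 3 / 6 - 1)"
    using assms by (simp add: field_simps power2_eq_square power3_eq_cube)
  also have "\<dots> \<le> x\<^sup>2 * (exp (1 / x) - 1)"
    using exp_ge_cubic_Taylor[of "1 / x"] by (intro mult_left_mono) auto
  finally show ?thesis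
    by (simp add: y_def)
qed

lemma Trigamma_gt:
  fixes x :: real
  assumes "x > 0"
  shows "1 / (x\<^sup>2 * (1 - exp (- (1 / x)))) < Polygamma 1 x"
proof -
  define g :: "real \<Rightarrow> real" where "g = (\<lambda>x. 1 / (x\<^sup>2 * (1 - exp (- (1 / x)))))"
  define f where "f = (\<lambda>x. Polygamma 1 x - g x)"
  have step: "f (z + 1) < f z" if z: "z > 0" for z
  proof -
    have recurrence: "Polygamma 1 (z + 1) = Polygamma 1 z - 1 / z\<^sup>2"
      using Polygamma_plus1[of z 1] z by (simp add: power2_eq_square)
    \<comment> \<open>With u = 1/z, this is 1/(1 - e^(-u)) = 1 + 1/(e^u - 1). Hence f(z) - f(z + 1)
      is a difference of the reciprocals of the two sides in
      \<open>exp_reciprocal_shift_less\<close>.\<close>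
    have "1 / z\<^sup>2 - g z = - (1 / (z\<^sup>2 * (exp (1 / z) - 1)))"
      using z by (simp add: g_def exp_minus divide_simps)
    moreover have "1 / (z\<^sup>2 * (exp (1 / z) - 1)) < g (z + 1)"
      unfolding g_def using z exp_reciprocal_shift_less[OF z]
      by (intro divide_strict_left_mono mult_pos_pos) auto
    ultimately show ?thesis
      using recurrence by (simp add: f_def)
  qed
  \<comment> \<open>The chain starts at \<open>x + 1\<close> because the limit yields only a weak
    inequality; the one remaining step from \<open>x\<close> makes it strict.\<close>
  have chain: "- g (x + 1 + real n) \<le> f (x + 1)" for n
  proof -
    have "f (x + 1 + real n) \<le> f (x + 1)"
    proof (induction n)
      case (Suc n)
      then show ?case
        using step[of "x + 1 + real n"] assms by (simp add: add_ac)
    qed simp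
    moreover have "Polygamma 1 (x + 1 + real n) > 0"
      using assms by (intro Polygamma_real_odd_pos) (auto elim: nonpos_Ints_cases)
    ultimately show ?thesis
      by (simp add: f_def)
  qed
  \<comment> \<open>1 - e^(-1/z) behaves like 1/z for large z, so g(z) behaves like 1/z.\<close>
  have "(\<lambda>n. - g (x + 1 + real n)) \<longlonglongrightarrow> 0"
    unfolding g_def by real_asymp
  then have "0 \<le> f (x + 1)"
    by (rule LIMSEQ_le_const2) (use chain in auto)
  then show ?thesis
    using step[OF assms] by (simp add: f_def g_def)
qed

theorem theorem1:
  shows "strict_mono_on {0<..}
           (\<lambda>x::real. deriv Gamma x / Gamma x + ln (exp (1 / x) - 1))"
proof (rule strict_mono_onI)
  fix a b :: real
  assume "a \<in> {0<..}" "b \<in> {0<..}" "a < b"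
  then have ab: "0 < a" "0 < b" "a < b"
    by auto
  have "Digamma a + ln (exp (1 / a) - 1) < Digamma b + ln (exp (1 / b) - 1)"
  proof (rule DERIV_pos_imp_increasing[OF ab(3)])
    fix x assume "a \<le> x" "x \<le> b"
    then have x: "x > 0"
      using ab by simp
    have "((\<lambda>x. Digamma x + ln (exp (1 / x) - 1)) has_real_derivative
             Polygamma 1 x - 1 / (x\<^sup>2 * (1 - exp (- (1 / x))))) (at x)"
      using x
      by (auto intro!: derivative_eq_intros elim: nonpos_Ints_cases)
         (simp add: exp_minus divide_simps power2_eq_square)
    then show "\<exists>y. ((\<lambda>x. Digamma x + ln (exp (1 / x) - 1)) has_real_derivative y) (at x) \<and> 0 < y"
      using Trigamma_gt[OF x] by auto
  qed
  then show "deriv Gamma a / Gamma a + ln (exp (1 / a) - 1)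
               < deriv Gamma b / Gamma b + ln (exp (1 / b) - 1)"
    using ab by (simp add: deriv_Gamma_divide_Gamma)
qed

end
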